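(* Let $G=(V,E)$ be a finite simple connected graph, $M_G=(m_{vw})_{v,w\in V}$ a real symmetric matrix, and $\Delta_G=\operatorname{diag}(f_v)_{v\in V}$ with all $f_v\in\mathbb{R}\setminus\{0\}$. Let $p_{\mathcal{A}_G}$ be the $\mathcal{A}$-blowup-polynomial, and define $u_{\mathcal{A}_G}(x):=p_{\mathcal{A}_G}(x,x,\dots,x)$. (1) Suppose all scalars $f_v$ are (nonzero and) of the same sign. Then $p_{\mathcal{A}_G}(\cdot)$ is real-stable. In particular, $u_{\mathcal{A}_G}$ is real-rooted. (2) Suppose in fact that all scalars $f_v$ are equal, say to $\lambda\ne0$. Then $x\in\mathbb{R}$ is a root of $u_{\mathcal{A}_G}$ if and only if $x\ne0$ and $-\lambda/x$ is an eigenvalue of $M_G$.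
   Context: The $\mathcal{A}$-blowup-polynomial of $G$, attached to $\mathcal{A}_G:=\Delta_G+M_G$, is the multi-affine polynomial $p_{\mathcal{A}_G}(\mathbf{n}):=\det(\Delta_G+\Delta_{\mathbf{n}}M_G)$ in the variables $\mathbf{n}=(n_v)_{v\in V}$, where $\Delta_{\mathbf{n}}:=\operatorname{diag}(n_v)_{v\in V}$. A polynomial with real coefficients is real-stable if it is nonzero whenever all its arguments lie in the open upper half-plane $\Im(z)>0$. A univariate real polynomial is real-rooted if all its complex roots are real. *)

theory Defs
  imports
    "HOL-Analysis.Analysis"
    "HOL-Library.Poly_Mapping"
    "HOL-Computational_Algebra.Polynomial"
    "Graph_Theory.Digraph_Component"
begin

text \<open>
  A polynomial with coefficients in \<open>'a\<close> in the variables \<open>(n\<^sub>v)\<close>, for \<open>v\<close> ranging over \<open>'v\<close>,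
  is a finitely supported map from monomials (finitely supported exponent maps) to \<open>'a\<close>;
  multiplication is the convolution product of the library.
\<close>

type_synonym ('v, 'a) mvpoly = "('v \<Rightarrow>\<^sub>0 nat) \<Rightarrow>\<^sub>0 'a"

definition mv_const :: "'a::zero \<Rightarrow> ('v, 'a) mvpoly" where
  "mv_const c = Poly_Mapping.single 0 c"

definition mv_var :: "'v \<Rightarrow> ('v, 'a::zero_neq_one) mvpoly" where
  "mv_var v = Poly_Mapping.single (Poly_Mapping.single v 1) 1"

text \<open>
  Substitution of \<open>x v\<close> for the variable indexed by \<open>v\<close>, the coefficients being sent to the
  target ring by \<open>h\<close>.
\<close>

definition mv_subst ::
  "('a::zero \<Rightarrow> 'b::comm_semiring_1) \<Rightarrow> ('v::finite \<Rightarrow> 'b) \<Rightarrow> ('v, 'a) mvpoly \<Rightarrow> 'b" where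
  "mv_subst h x p =
     (\<Sum>m\<in>Poly_Mapping.keys p.
        h (Poly_Mapping.lookup p m) * (\<Prod>v\<in>UNIV. x v ^ Poly_Mapping.lookup m v))"

definition diag_mat :: "('v::finite \<Rightarrow> 'a::zero) \<Rightarrow> 'a ^ 'v ^ 'v" where
  "diag_mat d = (\<chi> v w. if v = w then d v else 0)"

text \<open>The determinant is taken over the ring of real polynomials in the variables \<open>n\<^sub>v\<close>.\<close>

definition blowup_poly :: "('v::finite \<Rightarrow> real) \<Rightarrow> real ^ 'v ^ 'v \<Rightarrow> ('v, real) mvpoly" where
  "blowup_poly f M =
     det (diag_mat (\<lambda>v. mv_const (f v)) + diag_mat mv_var ** map_matrix mv_const M)"

definition univariate_blowup_poly :: "('v::finite \<Rightarrow> real) \<Rightarrow> real ^ 'v ^ 'v \<Rightarrow> real poly" where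
  "univariate_blowup_poly f M = mv_subst (\<lambda>c. [:c:]) (\<lambda>_. [:0, 1:]) (blowup_poly f M)"

definition real_stable :: "('v::finite, real) mvpoly \<Rightarrow> bool" where
  "real_stable p \<longleftrightarrow>
     (\<forall>z :: 'v \<Rightarrow> complex. (\<forall>v. Im (z v) > 0) \<longrightarrow> mv_subst complex_of_real z p \<noteq> 0)"

definition real_rooted :: "real poly \<Rightarrow> bool" where
  "real_rooted q \<longleftrightarrow> (\<forall>z :: complex. poly (map_poly complex_of_real q) z = 0 \<longrightarrow> z \<in> \<real>)"

definition is_eigenvalue :: "real ^ 'v ^ 'v \<Rightarrow> real \<Rightarrow> bool" where
  "is_eigenvalue M \<mu> \<longleftrightarrow> (\<exists>x. x \<noteq> 0 \<and> M *v x = \<mu> *\<^sub>R x)"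

end

theory Submission
  imports Defs
begin

text \<open>
  Substitution is a ring homomorphism, so it commutes with determinants, and the value of the
  blowup polynomial at a point \<open>z\<close> is \<open>det (diag f + diag z M)\<close>. If this vanishes, there is a
  nonzero vector \<open>y\<close> in the kernel: \<open>f\<^sub>v y\<^sub>v + z\<^sub>v (M y)\<^sub>v = 0\<close> for every \<open>v\<close>. When no \<open>z\<^sub>v\<close> is \<open>0\<close>,
  solving for \<open>(M y)\<^sub>v\<close> and pairing with the conjugate of \<open>y\<close> gives
  \<open>y\<^sup>* M y = - (\<Sum>v. f\<^sub>v |y\<^sub>v|\<^sup>2 / z\<^sub>v)\<close>. The left side is real because \<open>M\<close> is real symmetric; the right
  side has imaginary part \<open>\<Sum>v. f\<^sub>v Im z\<^sub>v |y\<^sub>v|\<^sup>2 / |z\<^sub>v|\<^sup>2\<close>, which cannot be \<open>0\<close> if the numbers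
  \<open>f\<^sub>v Im z\<^sub>v\<close> are nonzero and all of one sign. This is \<open>blowup_poly_nonzero\<close>.

  It yields stability directly. It also yields real-rootedness, since a nonreal \<open>z\<close>, substituted for
  every variable, satisfies the sign condition in the lower half-plane as well as in the upper one.
  For \<open>f\<close> constant with value \<open>\<lambda>\<close>, the kernel equation at a real point reads \<open>\<lambda> y + x M y = 0\<close>, which excludes
  \<open>x = 0\<close> and otherwise is the eigenvector equation for \<open>- \<lambda> / x\<close>.
\<close>

section \<open>Determinants under ring homomorphisms\<close>

locale unital_ring_hom =
  fixes g :: "'a::comm_ring_1 \<Rightarrow> 'b::comm_ring_1"
  assumes hom_add: "g (a + b) = g a + g b"
    and hom_mult: "g (a * b) = g a * g b"
    and hom_one: "g 1 = 1"
begin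

lemma hom_zero: "g 0 = 0"
  using hom_add[of 0 0] by simp

lemma hom_uminus: "g (- a) = - g a"
  using hom_add[of a "- a"] hom_zero by (simp add: add_eq_0_iff)

lemma hom_sum: "g (sum k A) = (\<Sum>i\<in>A. g (k i))"
  by (induction A rule: infinite_finite_induct) (simp_all add: hom_zero hom_add)

lemma hom_prod: "g (prod k A) = (\<Prod>i\<in>A. g (k i))"
  by (induction A rule: infinite_finite_induct) (simp_all add: hom_one hom_mult)

lemma hom_det: "g (det A) = det (map_matrix g A)"
proof -
  have sgn: "g (of_int (sign p)) = of_int (sign p)" for p :: "'c \<Rightarrow> 'c"
    by (simp add: sign_def hom_one hom_uminus)
  show ?thesis
    unfolding det_def by (simp add: hom_sum hom_mult hom_prod sgn)
qed

end

section \<open>The pencil of a diagonal matrix and a row-scaled matrix\<close>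

lemma diag_mat_nth: "diag_mat d $ v $ w = (if v = w then d v else 0)"
  by (simp add: diag_mat_def)

lemma diag_mat_mult_nth: "(diag_mat d ** N) $ v $ w = d v * N $ v $ w"
  by (simp add: diag_mat_def matrix_matrix_mult_def if_distrib[of "\<lambda>c. c * _"] cong: if_cong)

lemma diag_pencil_mult_vec_nth:
  "((diag_mat d + diag_mat x ** N) *v y) $ v = d v * y $ v + x v * (N *v y) $ v"
proof -
  have "((diag_mat d + diag_mat x ** N) *v y) $ v
      = (\<Sum>w\<in>UNIV. (if v = w then d v * y $ w else 0) + x v * (N $ v $ w * y $ w))"
    unfolding matrix_vector_mult_def
    by (auto intro!: sum.cong simp: diag_mat_mult_nth diag_mat_nth algebra_simps)
  then show ?thesis
    by (simp add: sum.distrib sum_distrib_left matrix_vector_mult_def)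
qed

lemma (in unital_ring_hom) hom_det_diag_pencil:
  "g (det (diag_mat d + diag_mat x ** N))
     = det (diag_mat (\<lambda>v. g (d v)) + diag_mat (\<lambda>v. g (x v)) ** map_matrix g N)"
  unfolding hom_det
  by (rule arg_cong[where f = det])
     (simp add: vec_eq_iff diag_mat_mult_nth hom_add hom_mult diag_mat_nth hom_zero)

section \<open>Substitution as a ring homomorphism\<close>

text \<open>
  Two polynomials may have different supports; summing both over a common superset makes their
  values termwise comparable.
\<close>

lemma mv_subst_superset:
  assumes "finite K" "Poly_Mapping.keys p \<subseteq> K" "h 0 = 0"
  shows "mv_subst h x p
    = (\<Sum>m\<in>K. h (Poly_Mapping.lookup p m) * (\<Prod>v\<in>UNIV. x v ^ Poly_Mapping.lookup m v))"
  unfolding mv_subst_def using assms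
  by (intro sum.mono_neutral_left) (auto simp: in_keys_iff)

lemma mv_subst_single:
  assumes "h 0 = 0"
  shows "mv_subst h x (Poly_Mapping.single m c)
    = h c * (\<Prod>v\<in>UNIV. x v ^ Poly_Mapping.lookup m v)"
  using mv_subst_superset[of "{m}" "Poly_Mapping.single m c" h x] assms by simp

context unital_ring_hom
begin

lemma mv_subst_add: "mv_subst g x (p + q) = mv_subst g x p + mv_subst g x q"
proof -
  let ?K = "Poly_Mapping.keys p \<union> Poly_Mapping.keys q"
  have "mv_subst g x r
      = (\<Sum>m\<in>?K. g (Poly_Mapping.lookup r m) * (\<Prod>v\<in>UNIV. x v ^ Poly_Mapping.lookup m v))"
    if "Poly_Mapping.keys r \<subseteq> ?K" for r
    using that by (intro mv_subst_superset) (auto simp: hom_zero)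
  then show ?thesis
    using keys_add[of p q] by (simp add: lookup_add hom_add algebra_simps sum.distrib)
qed

text \<open>
  Both sides are biadditive, so splitting the factors into monomial terms leaves the case of two
  monomial terms, whose exponents add.
\<close>

lemma mv_subst_mult:
  fixes p q :: "('v::finite, 'a) mvpoly"
  shows "mv_subst g x (p * q) = mv_subst g x p * mv_subst g x q"
proof -
  have subst_sum: "mv_subst g x (sum k A) = (\<Sum>i\<in>A. mv_subst g x (k i))"
    for k and A :: "('v \<Rightarrow>\<^sub>0 nat) set"
    by (induction A rule: infinite_finite_induct) (simp_all add: mv_subst_add, simp_all add: mv_subst_def)
  let ?t = "\<lambda>r m. Poly_Mapping.single m (Poly_Mapping.lookup r m)"
  have monomials: "r = (\<Sum>m\<in>Poly_Mapping.keys r. ?t r m)" for r :: "('v, 'a) mvpoly"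
    by (simp add: poly_mapping_eqI lookup_sum lookup_single when_def in_keys_iff)
  have "mv_subst g x (p * q)
      = mv_subst g x (\<Sum>m\<in>Poly_Mapping.keys p. \<Sum>n\<in>Poly_Mapping.keys q. ?t p m * ?t q n)"
    by (subst (1) monomials[of p], subst (1) monomials[of q]) (simp only: sum_product)
  also have "\<dots> = (\<Sum>m\<in>Poly_Mapping.keys p. \<Sum>n\<in>Poly_Mapping.keys q.
      mv_subst g x (?t p m) * mv_subst g x (?t q n))"
    by (simp add: subst_sum mult_single mv_subst_single hom_zero hom_mult lookup_add power_add
        prod.distrib mult_ac)
  also have "\<dots> = mv_subst g x p * mv_subst g x q"
    by (simp add: sum_product[symmetric] subst_sum[symmetric] monomials[symmetric])
  finally show ?thesis .
qed

lemma mv_subst_hom: "unital_ring_hom (mv_subst g x)"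
proof
  show "mv_subst g x 1 = 1"
    unfolding single_one[symmetric] by (simp add: mv_subst_single hom_zero hom_one del: single_one)
qed (rule mv_subst_add mv_subst_mult)+

end

section \<open>Values of the blowup polynomials\<close>

lemma mv_subst_blowup_poly:
  fixes h :: "real \<Rightarrow> 'b::comm_ring_1"
  assumes "unital_ring_hom h"
  shows "mv_subst h x (blowup_poly f M)
    = det (diag_mat (\<lambda>v. h (f v)) + diag_mat x ** map_matrix h M)"
proof -
  interpret h: unital_ring_hom h by fact
  interpret s: unital_ring_hom "mv_subst h x" by (rule h.mv_subst_hom)
  have "mv_subst h x (mv_const c) = h c" for c
    by (simp add: mv_const_def mv_subst_single h.hom_zero)
  moreover have "mv_subst h x (mv_var v) = x v" for v
  proof -
    have "(\<Prod>w\<in>UNIV. x w ^ Poly_Mapping.lookup (Poly_Mapping.single v 1) w)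
        = (\<Prod>w\<in>UNIV. if v = w then x w else 1)"
      by (intro prod.cong) (auto simp: lookup_single when_def)
    then show ?thesis
      by (simp add: mv_var_def mv_subst_single h.hom_zero h.hom_one)
  qed
  ultimately show ?thesis
    unfolding blowup_poly_def s.hom_det_diag_pencil
    by (simp add: map_matrix_def)
qed

lemma of_real_hom: "unital_ring_hom complex_of_real"
  by unfold_locales simp_all

lemma const_poly_hom: "unital_ring_hom (\<lambda>c::'a::comm_ring_1. [:c:])"
  by unfold_locales (simp_all add: one_pCons)

lemma poly_hom: "unital_ring_hom (\<lambda>q. poly q (x::'a::comm_ring_1))"
  by unfold_locales simp_all

lemma poly_of_real_hom: "unital_ring_hom (\<lambda>q. poly (map_poly complex_of_real q) z)"
proof
  have pCons: "poly (map_poly complex_of_real (pCons a p)) z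
      = of_real a + z * poly (map_poly complex_of_real p) z" for a p
    by (simp add: map_poly_pCons)
  show add: "poly (map_poly complex_of_real (p + q)) z
      = poly (map_poly complex_of_real p) z + poly (map_poly complex_of_real q) z" for p q
    by (induction p q rule: poly_induct2) (simp_all add: pCons algebra_simps)
  have smult: "poly (map_poly complex_of_real (smult a p)) z
      = of_real a * poly (map_poly complex_of_real p) z" for a p
    by (induction p) (simp_all add: pCons algebra_simps)
  show "poly (map_poly complex_of_real (p * q)) z
      = poly (map_poly complex_of_real p) z * poly (map_poly complex_of_real q) z" for p q
    by (induction p) (simp_all add: pCons add smult algebra_simps)
  show "poly (map_poly complex_of_real 1) z = 1"
    by (simp add: one_pCons map_poly_pCons)
qed

lemma poly_univariate_blowup_poly:
  "poly (univariate_blowup_poly f M) x = det (diag_mat f + diag_mat (\<lambda>_. x) ** M)"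
  unfolding univariate_blowup_poly_def mv_subst_blowup_poly[OF const_poly_hom]
    unital_ring_hom.hom_det_diag_pencil[OF poly_hom]
  by (simp add: map_matrix_def)

lemma poly_of_real_univariate_blowup_poly:
  "poly (map_poly complex_of_real (univariate_blowup_poly f M)) z
     = mv_subst complex_of_real (\<lambda>_. z) (blowup_poly f M)"
  unfolding univariate_blowup_poly_def mv_subst_blowup_poly[OF const_poly_hom]
    mv_subst_blowup_poly[OF of_real_hom] unital_ring_hom.hom_det_diag_pencil[OF poly_of_real_hom]
  by (simp add: map_matrix_def map_poly_pCons)

section \<open>Nonvanishing of the blowup polynomial\<close>

lemma det_eq_0_iff_kernel:
  fixes A :: "'a::field ^ 'n ^ 'n"
  shows "det A = 0 \<longleftrightarrow> (\<exists>y. y \<noteq> 0 \<and> A *v y = 0)"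
  using invertible_det_nz[of A] invertible_left_inverse[of A] matrix_left_invertible_ker[of A]
  by blast

text \<open>
  Conjugation only interchanges the two summation indices, because the entries of \<open>M\<close> are real
  and symmetric.
\<close>

lemma symmetric_hermitian_form_real:
  fixes M :: "real ^ 'n ^ 'n" and y :: "complex ^ 'n"
  assumes "transpose M = M"
  shows "(\<Sum>v\<in>UNIV. cnj (y $ v) * (map_matrix complex_of_real M *v y) $ v) \<in> \<real>"
proof -
  have sym: "M $ v $ w = M $ w $ v" for v w
    by (metis assms transpose_def vec_lambda_beta)
  let ?s = "\<Sum>v\<in>UNIV. \<Sum>w\<in>UNIV. cnj (y $ v) * (of_real (M $ v $ w) * y $ w)"
  have "cnj ?s = (\<Sum>v\<in>UNIV. \<Sum>w\<in>UNIV. cnj (y $ w) * (of_real (M $ w $ v) * y $ v))"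
    by (simp add: sym mult_ac)
  also have "\<dots> = ?s"
    by (rule sum.swap)
  finally show ?thesis
    by (simp add: matrix_vector_mult_def sum_distrib_left Reals_cnj_iff)
qed

text \<open>
  The factor \<open>c\<close> records the common sign of the numbers \<open>f\<^sub>v Im z\<^sub>v\<close>. Constraining only this product
  covers both signs of \<open>f\<close> and both half-planes at once.
\<close>

lemma blowup_poly_nonzero:
  fixes M :: "real ^ 'v::finite ^ 'v" and f :: "'v \<Rightarrow> real"
  assumes sym: "transpose M = M"
    and same_sign: "\<And>v. c * (f v * Im (z v)) > 0"
  shows "mv_subst complex_of_real z (blowup_poly f M) \<noteq> 0"
proof
  let ?M = "map_matrix complex_of_real M"
  assume "mv_subst complex_of_real z (blowup_poly f M) = 0"
  then obtain y where y: "y \<noteq> 0"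
    and ker: "(diag_mat (\<lambda>v. complex_of_real (f v)) + diag_mat z ** ?M) *v y = 0"
    unfolding mv_subst_blowup_poly[OF of_real_hom] det_eq_0_iff_kernel by blast
  have z: "z v \<noteq> 0" for v
    using same_sign[of v] by auto
  have My: "(?M *v y) $ v = - (of_real (f v) * y $ v / z v)" for v
    using arg_cong[OF ker, of "\<lambda>u. u $ v"] z[of v]
    by (simp add: diag_pencil_mult_vec_nth field_simps add_eq_0_iff2)
  \<comment> \<open>Since \<open>- Im (1 / z) = Im z / |z|\<^sup>2\<close>, the minus sign in \<open>My\<close> disappears.\<close>
  have Im_term: "Im (cnj (y $ v) * (?M *v y) $ v)
      = f v * Im (z v) * ((cmod (y $ v) / cmod (z v)) ^ 2)" for v
  proof -
    have "cnj (y $ v) * (?M *v y) $ v = of_real (- (f v * (cmod (y $ v))\<^sup>2)) / z v"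
      unfolding My using complex_norm_square[of "y $ v"] by (simp add: mult_ac)
    then show ?thesis
      by (simp add: Im_divide cmod_power2 power_divide)
  qed
  have "(\<Sum>v\<in>UNIV. c * (f v * Im (z v)) * ((cmod (y $ v) / cmod (z v)) ^ 2))
      = c * Im (\<Sum>v\<in>UNIV. cnj (y $ v) * (?M *v y) $ v)"
    by (simp only: Im_sum Im_term sum_distrib_left mult.assoc)
  also have "\<dots> = 0"
    using symmetric_hermitian_form_real[OF sym, of y] by (simp only: complex_is_Real_iff mult_zero_right)
  finally have "(\<Sum>v\<in>UNIV. c * (f v * Im (z v)) * ((cmod (y $ v) / cmod (z v)) ^ 2)) = 0" .
  then have "c * (f v * Im (z v)) * ((cmod (y $ v) / cmod (z v)) ^ 2) = 0" for v
    by (subst (asm) sum_nonneg_eq_0_iff) (auto intro!: mult_nonneg_nonneg[OF less_imp_le[OF same_sign] zero_le_power2])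
  then have "y $ v = 0" for v
    using same_sign[of v] z[of v] by (metis divide_eq_0_iff less_irrefl mult_eq_0_iff norm_eq_zero
        power_not_zero)
  with y show False
    by (simp add: vec_eq_iff)
qed

section \<open>Stability, real-rootedness and eigenvalues\<close>

theorem theorem3p1:
  fixes G :: "'v::finite pair_pre_digraph"
    and M :: "real ^ 'v ^ 'v"
    and f :: "'v \<Rightarrow> real"
  assumes "pair_graph G" and "Digraph_Component.connected (with_proj G)"
    and "pverts G = UNIV"
    and "transpose M = M"
    and "\<And>v. f v \<noteq> 0"
  shows "((\<forall>v. f v > 0) \<or> (\<forall>v. f v < 0) \<longrightarrow>
            real_stable (blowup_poly f M) \<and> real_rooted (univariate_blowup_poly f M))
       \<and> (\<forall>l. l \<noteq> 0 \<and> (\<forall>v. f v = l) \<longrightarrow>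
            (\<forall>x. poly (univariate_blowup_poly f M) x = 0 \<longleftrightarrow>
                 x \<noteq> 0 \<and> is_eigenvalue M (- l / x)))"
proof (intro conjI allI impI)
  assume "(\<forall>v. f v > 0) \<or> (\<forall>v. f v < 0)"
  then obtain s where s: "s * f v > 0" for v
    by (metis less_numeral_extra(1) mult_1 mult_minus1 neg_0_less_iff_less)
  show "real_stable (blowup_poly f M)"
    unfolding real_stable_def
  proof (intro allI impI)
    fix z :: "'v \<Rightarrow> complex"
    assume "\<forall>v. Im (z v) > 0"
    then have "s * (f v * Im (z v)) > 0" for v
      using s[of v] by (metis mult.assoc mult_pos_pos)
    then show "mv_subst complex_of_real z (blowup_poly f M) \<noteq> 0"
      by (rule blowup_poly_nonzero[OF assms(4)])
  qed
  show "real_rooted (univariate_blowup_poly f M)"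
    unfolding real_rooted_def poly_of_real_univariate_blowup_poly
  proof (intro allI impI, rule ccontr)
    fix z
    assume root: "mv_subst complex_of_real (\<lambda>_. z) (blowup_poly f M) = 0" and "z \<notin> \<real>"
    then have "Im z * Im z > 0"
      by (metis complex_is_Real_iff not_real_square_gt_zero)
    \<comment> \<open>Choosing \<open>s * Im z\<close> as the common sign treats the two half-planes together.\<close>
    then have "(s * Im z) * (f v * Im z) > 0" for v
      using mult_pos_pos[OF s[of v]] by (metis mult.assoc mult.left_commute mult.commute)
    then have "mv_subst complex_of_real (\<lambda>_. z) (blowup_poly f M) \<noteq> 0"
      by (rule blowup_poly_nonzero[where z = "\<lambda>_. z", OF assms(4)])
    with root show False
      by contradiction
  qed
next
  fix l x
  assume "l \<noteq> 0 \<and> (\<forall>v. f v = l)"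
  then have l: "l \<noteq> 0" and f: "f = (\<lambda>_. l)"
    by auto
  have pencil: "(diag_mat (\<lambda>_. l) + diag_mat (\<lambda>_. x) ** M) *v y = l *\<^sub>R y + x *\<^sub>R (M *v y)" for y
    by (simp add: vec_eq_iff diag_pencil_mult_vec_nth)
  have "l *\<^sub>R y + x *\<^sub>R (M *v y) = 0 \<longleftrightarrow> x \<noteq> 0 \<and> M *v y = (- l / x) *\<^sub>R y" if "y \<noteq> 0" for y
    using l that by (cases "x = 0") (auto simp: vec_eq_iff field_simps add_eq_0_iff)
  then show "poly (univariate_blowup_poly f M) x = 0 \<longleftrightarrow> x \<noteq> 0 \<and> is_eigenvalue M (- l / x)"
    unfolding poly_univariate_blowup_poly f det_eq_0_iff_kernel pencil is_eigenvalue_def by blast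
qed

end
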